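(* If $Q=(q_n)_{n=1}^\infty$ is a dynamically generated basic sequence, then $\mathcal{URN}(Q)=\mathcal{UN}(Q)$.
   Context: Notation: $\mathbb{N}=\{1,2,\dots\}$, $\mathbb{N}_0=\mathbb{N}\cup\{0\}$, $\mathbb{N}_{\ge 2}=\{2,3,\dots\}$. A basic sequence is a sequence $Q=(q_n)_{n=1}^\infty$ with $q_n\in\mathbb{N}_{\ge 2}$. Every $z\in[0,1)$ has a unique expansion $z=\sum_{n\ge1}\frac{z_n}{q_1\cdots q_n}$ with $z_n\in\{0,\dots,q_n-1\}$ and $z_n\ne q_n-1$ for infinitely many $n$. A continuous measure preserving system $(X,\mathscr{B},\mu,T)$ consists of a complete separable metric space $X$, its Borel $\sigma$-algebra $\mathscr{B}$, a probability measure $\mu$ on $\mathscr{B}$ giving positive measure to every nonempty open set, and a continuous $\mu$-preserving map $T:X\to X$. A point $x\in X$ is generic if $\frac1N\sum_{n=1}^N h(T^nx)\to\int_X h\,d\mu$ for every continuous $h:X\to\mathbb{C}$ with $h\in L^1(X,\mu)$. A continuous $f:X\to\mathbb{N}_{\ge2}$ (discrete target) generates the topology of $X$ if the topology of $X$ is the smallest topology $\tau$ on $X$ for which $f$ is continuous and $T^{-1}U\in\tau$ for all $U\in\tau$. $Q$ is dynamically generated if there exist a continuous measure preserving system $(X,\mathscr{B},\mu,T)$, a continuous $f:X\to\mathbb{N}_{\ge2}$ generating the topology of $X$, and a generic point $x\in X$ with $q_n=f(T^nx)$ for all $n\ge1$. For $D=(d_1,\dots,d_\ell)\in\mathbb{N}_0^\ell$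 and $B=(b_1,\dots,b_\ell)\in\mathbb{N}_{\ge2}^\ell$ let $S_B=\{j\in\mathbb{N}: (q_j,\dots,q_{j+\ell-1})=B\}$; let $Q_n(D,B)=\frac{|S_B\cap[1,n]|}{b_1\cdots b_\ell}$ if $d_i<b_i$ for all $i$, and $Q_n(D,B)=0$ otherwise; and $N_n^Q(D,B,z)=\#\{j\in S_B\cap[1,n]: z_{j+i-1}=d_i\ \forall\,1\le i\le\ell\}$. $\mathcal{UN}(Q)$ is the set of $z\in[0,1)$ such that for all $\ell\in\mathbb{N}$ and all $D\in\mathbb{N}_0^\ell$, $B\in\mathbb{N}_{\ge2}^\ell$ with $\lim_n Q_n(D,B)=\infty$ we have $\lim_n N_n^Q(D,B,z)/Q_n(D,B)=1$. $\mathcal{URN}(Q)$ (uniformly $Q$-ratio normal numbers) is the set of $z\in[0,1)$ such that for every $\ell\in\mathbb{N}$ and all $D_1,D_2\in\mathbb{N}_0^\ell$, $B_1,B_2\in\mathbb{N}_{\ge2}^\ell$ such that, for $i=1,2$, every entry of $D_i$ is strictly less than the corresponding entry of $B_i$ and $B_i$ occurs in $Q$ (i.e. $S_{B_i}\neq\emptyset$), we have $$\lim_{n\to\infty}\frac{N_n^Q(D_1,B_1,z)/Q_n(D_1,B_1)}{N_n^Q(D_2,B_2,z)/Q_n(D_2,B_2)}=1.$$ *)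

theory Defs
  imports "HOL-Probability.Probability"
begin

text \<open>Sequences are indexed from 1; the value of a basic sequence at 0 is irrelevant.\<close>

definition basic_sequence :: "(nat \<Rightarrow> nat) \<Rightarrow> bool" where
  "basic_sequence Q \<longleftrightarrow> (\<forall>n\<ge>1. Q n \<ge> 2)"

definition is_cantor_expansion :: "(nat \<Rightarrow> nat) \<Rightarrow> real \<Rightarrow> (nat \<Rightarrow> nat) \<Rightarrow> bool" where
  "is_cantor_expansion Q z d \<longleftrightarrow>
     (\<forall>n\<ge>1. d n < Q n) \<and>
     infinite {n. n \<ge> 1 \<and> d n \<noteq> Q n - 1} \<and>
     (\<lambda>n. real (d (Suc n)) / (\<Prod>k=1..Suc n. real (Q k))) sums z"

text \<open>For a basic sequence \<open>Q\<close> and \<open>0 \<le> z < 1\<close> the expansion is unique up to its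
  irrelevant value at index 0, which is fixed to be 0 here to make the description definite.\<close>

definition cantor_digit :: "(nat \<Rightarrow> nat) \<Rightarrow> real \<Rightarrow> nat \<Rightarrow> nat" where
  "cantor_digit Q z = (THE d. is_cantor_expansion Q z d \<and> d 0 = 0)"

text \<open>The complete separable metric space is a type of class \<^class>\<open>polish_space\<close>.\<close>

definition continuous_mps :: "('a::polish_space) measure \<Rightarrow> ('a \<Rightarrow> 'a) \<Rightarrow> bool" where
  "continuous_mps \<mu> T \<longleftrightarrow>
     sets \<mu> = sets borel \<and> prob_space \<mu> \<and>
     (\<forall>U. open U \<and> U \<noteq> {} \<longrightarrow> emeasure \<mu> U > 0) \<and>
     continuous_on UNIV T \<and>
     (\<forall>A\<in>sets \<mu>. emeasure \<mu> (T -` A) = emeasure \<mu> A)"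

definition generic_point :: "('a::polish_space) measure \<Rightarrow> ('a \<Rightarrow> 'a) \<Rightarrow> 'a \<Rightarrow> bool" where
  "generic_point \<mu> T x \<longleftrightarrow>
     (\<forall>h :: 'a \<Rightarrow> complex. continuous_on UNIV h \<and> integrable \<mu> h \<longrightarrow>
        (\<lambda>N. (\<Sum>n=1..N. h ((T ^^ n) x)) / of_nat N) \<longlonglongrightarrow> integral\<^sup>L \<mu> h)"

definition admissible_topology :: "('a \<Rightarrow> 'a) \<Rightarrow> ('a \<Rightarrow> nat) \<Rightarrow> 'a topology \<Rightarrow> bool" where
  "admissible_topology T f \<tau> \<longleftrightarrow>
     topspace \<tau> = UNIV \<and>
     continuous_map \<tau> (discrete_topology {2..}) f \<and>
     (\<forall>U. openin \<tau> U \<longrightarrow> openin \<tau> (T -` U))"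

definition generates_topology :: "('a::topological_space \<Rightarrow> 'a) \<Rightarrow> ('a \<Rightarrow> nat) \<Rightarrow> bool" where
  "generates_topology T f \<longleftrightarrow>
     admissible_topology T f euclidean \<and>
     (\<forall>\<tau>. admissible_topology T f \<tau> \<longrightarrow> (\<forall>U. open U \<longrightarrow> openin \<tau> U))"

text \<open>HOL cannot quantify over types inside a formula, so the type of points of the system
  is a parameter. As dynamical generation is only used as a hypothesis, leaving that type
  variable free (hence universally quantified) amounts to the existence of some system.\<close>

definition dynamically_generated :: "('a::polish_space) itself \<Rightarrow> (nat \<Rightarrow> nat) \<Rightarrow> bool" where
  "dynamically_generated _ Q \<longleftrightarrow>
     (\<exists>(\<mu> :: 'a measure) T f x.
        continuous_mps \<mu> T \<and>
        continuous_map euclidean (discrete_topology {2..}) f \<and>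
        generates_topology T f \<and>
        generic_point \<mu> T x \<and>
        (\<forall>n\<ge>1. Q n = f ((T ^^ n) x)))"

definition block_positions :: "(nat \<Rightarrow> nat) \<Rightarrow> nat list \<Rightarrow> nat set" where
  "block_positions Q B = {j. j \<ge> 1 \<and> (\<forall>i<length B. Q (j + i) = B ! i)}"

definition expected_count :: "(nat \<Rightarrow> nat) \<Rightarrow> nat list \<Rightarrow> nat list \<Rightarrow> nat \<Rightarrow> real" where
  "expected_count Q D B n =
     (if list_all2 (<) D B
      then real (card (block_positions Q B \<inter> {1..n})) / real (prod_list B) else 0)"

definition block_count :: "(nat \<Rightarrow> nat) \<Rightarrow> nat list \<Rightarrow> nat list \<Rightarrow> real \<Rightarrow> nat \<Rightarrow> nat" where
  "block_count Q D B z n =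
     card {j \<in> block_positions Q B \<inter> {1..n}. \<forall>i<length D. cantor_digit Q z (j + i) = D ! i}"

definition unif_normal :: "(nat \<Rightarrow> nat) \<Rightarrow> real set" where
  "unif_normal Q = {z \<in> {0..<1}.
     \<forall>l\<ge>1. \<forall>D B.
       length D = l \<and> length B = l \<and> (\<forall>b\<in>set B. b \<ge> 2) \<and>
       filterlim (expected_count Q D B) at_top sequentially \<longrightarrow>
       (\<lambda>n. real (block_count Q D B z n) / expected_count Q D B n) \<longlonglongrightarrow> 1}"

text \<open>Since division by zero yields 0, convergence to 1 below forces all denominators to be
  nonzero for large \<open>n\<close>, so the totalised quotient does not enlarge the set.\<close>

definition unif_ratio_normal :: "(nat \<Rightarrow> nat) \<Rightarrow> real set" where
  "unif_ratio_normal Q = {z \<in> {0..<1}.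
     \<forall>l\<ge>1. \<forall>D\<^sub>1 D\<^sub>2 B\<^sub>1 B\<^sub>2.
       length D\<^sub>1 = l \<and> length D\<^sub>2 = l \<and> length B\<^sub>1 = l \<and> length B\<^sub>2 = l \<and>
       (\<forall>b\<in>set B\<^sub>1. b \<ge> 2) \<and> (\<forall>b\<in>set B\<^sub>2. b \<ge> 2) \<and>
       list_all2 (<) D\<^sub>1 B\<^sub>1 \<and> list_all2 (<) D\<^sub>2 B\<^sub>2 \<and>
       block_positions Q B\<^sub>1 \<noteq> {} \<and> block_positions Q B\<^sub>2 \<noteq> {} \<longrightarrow>
       (\<lambda>n. (real (block_count Q D\<^sub>1 B\<^sub>1 z n) / expected_count Q D\<^sub>1 B\<^sub>1 n) /
            (real (block_count Q D\<^sub>2 B\<^sub>2 z n) / expected_count Q D\<^sub>2 B\<^sub>2 n)) \<longlonglongrightarrow> 1}"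

end

theory Submission
  imports Defs
begin

text \<open>Blocks occurring in a dynamically generated sequence have positive frequency: the
  corresponding cylinder is clopen and nonempty, so its indicator may be tested against the
  generic point. Hence uniform normality applies to every occurring block, and the quotient of
  two ratios tending to 1 tends to 1. Conversely, for fixed \<open>B\<close> the ratios
  \<open>N\<^sub>n(D,B,z) / Q\<^sub>n(D,B)\<close> have average exactly 1 over all digit blocks \<open>D < B\<close>; if they are
  pairwise asymptotic, each of them tends to 1.\<close>

section \<open>Cantor series expansions\<close>

definition base_prod :: "(nat \<Rightarrow> nat) \<Rightarrow> nat \<Rightarrow> real" where
  "base_prod Q n = (\<Prod>k=1..n. real (Q k))"

text \<open>Numerator of the n-th partial sum over the common denominator
  \<open>base_prod Q n\<close>. Keeping it an integer allows it to be recognised as a floor.\<close>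

primrec digit_int :: "(nat \<Rightarrow> nat) \<Rightarrow> (nat \<Rightarrow> nat) \<Rightarrow> nat \<Rightarrow> int" where
  "digit_int Q d 0 = 0"
| "digit_int Q d (Suc n) = int (Q (Suc n)) * digit_int Q d n + int (d (Suc n))"

lemma base_prod_0 [simp]: "base_prod Q 0 = 1"
  by (simp add: base_prod_def)

lemma base_prod_Suc [simp]: "base_prod Q (Suc n) = real (Q (Suc n)) * base_prod Q n"
  by (simp add: base_prod_def)

context
  fixes Q :: "nat \<Rightarrow> nat"
  assumes Q: "basic_sequence Q"
begin

lemma base_ge_2: "Q (Suc n) \<ge> 2"
  using Q by (simp add: basic_sequence_def)

lemma base_prod_ge: "base_prod Q n \<ge> 2 ^ n"
proof (induction n)
  case (Suc n)
  have "(2::real) * 2 ^ n \<le> real (Q (Suc n)) * base_prod Q n"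
    using base_ge_2[of n] Suc by (intro mult_mono) auto
  then show ?case by simp
qed simp

lemma base_prod_pos: "base_prod Q n > 0"
  using base_prod_ge[of n] by (smt (verit) zero_less_power)

lemma inverse_base_prod_tendsto_0: "(\<lambda>n. 1 / base_prod Q n) \<longlonglongrightarrow> 0"
proof (rule tendsto_sandwich)
  show "\<forall>\<^sub>F n in sequentially. 0 \<le> 1 / base_prod Q n"
    using base_prod_pos by (simp add: less_imp_le)
  show "\<forall>\<^sub>F n in sequentially. 1 / base_prod Q n \<le> (1/2) ^ n"
    using base_prod_ge base_prod_pos by (simp add: power_divide frac_le)
  show "(\<lambda>n. (1/2::real) ^ n) \<longlonglongrightarrow> 0"
    by (intro LIMSEQ_power_zero) simp
qed simp

lemma partial_sum_eq_digit_int: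
  "(\<Sum>k<n. real (d (Suc k)) / base_prod Q (Suc k)) = digit_int Q d n / base_prod Q n"
proof (induction n)
  case (Suc n)
  have "real (Q (Suc n)) \<noteq> 0" using base_ge_2[of n] by simp
  then show ?case
    using Suc base_prod_pos[of n] by (simp add: field_simps)
qed simp

lemma is_cantor_expansion_iff:
  "is_cantor_expansion Q z d \<longleftrightarrow>
     (\<forall>n. d (Suc n) < Q (Suc n)) \<and>
     (\<forall>n. \<exists>m\<ge>n. d (Suc m) \<noteq> Q (Suc m) - 1) \<and>
     (\<lambda>n. digit_int Q d n / base_prod Q n) \<longlonglongrightarrow> z"
proof -
  have "(\<forall>n\<ge>1. d n < Q n) \<longleftrightarrow> (\<forall>n. d (Suc n) < Q (Suc n))"
    by (metis One_nat_def Suc_le_D Suc_le_mono le0)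
  moreover have "infinite {n. n \<ge> 1 \<and> d n \<noteq> Q n - 1} \<longleftrightarrow>
      (\<forall>n. \<exists>m\<ge>n. d (Suc m) \<noteq> Q (Suc m) - 1)"
  proof -
    have "(\<exists>m>n. 1 \<le> m \<and> d m \<noteq> Q m - 1) \<longleftrightarrow> (\<exists>m\<ge>n. d (Suc m) \<noteq> Q (Suc m) - 1)" for n
      by (metis One_nat_def Suc_le_D Suc_le_eq Suc_le_mono le0)
    then show ?thesis by (simp add: infinite_nat_iff_unbounded)
  qed
  moreover have "(\<lambda>n. real (d (Suc n)) / (\<Prod>k=1..Suc n. real (Q k))) sums z \<longleftrightarrow>
      (\<lambda>n. digit_int Q d n / base_prod Q n) \<longlonglongrightarrow> z"
    unfolding sums_def base_prod_def[symmetric] partial_sum_eq_digit_int ..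
  ultimately show ?thesis
    unfolding is_cantor_expansion_def by simp
qed

text \<open>The lower ends \<open>?a n / ?P n\<close> increase to \<open>z\<close> and the upper
  ends \<open>(?a n + 1) / ?P n\<close> decrease to \<open>z\<close>, because each digit lies in the
  range from 0 to its base minus 1. Hence \<open>z\<close> lies between them, and the floor follows
  once \<open>z\<close> is strictly below the upper end.\<close>

lemma floor_eq_digit_int:
  assumes "is_cantor_expansion Q z d"
  shows "\<lfloor>z * base_prod Q n\<rfloor> = digit_int Q d n"
proof -
  let ?a = "\<lambda>n. real_of_int (digit_int Q d n)" and ?P = "base_prod Q"
  have lt: "d (Suc m) < Q (Suc m)" for m
    using assms by (auto simp: is_cantor_expansion_iff)
  have lim: "(\<lambda>n. ?a n / ?P n) \<longlonglongrightarrow> z"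
    using assms by (auto simp: is_cantor_expansion_iff)
  obtain j where j: "j \<ge> n" "d (Suc j) \<noteq> Q (Suc j) - 1"
    using assms by (auto simp: is_cantor_expansion_iff)
  have Qpos: "real (Q (Suc m)) > 0" for m using base_ge_2[of m] by simp
  have inc: "?a m / ?P m \<le> ?a (Suc m) / ?P (Suc m)" for m
    using base_prod_pos[of m] Qpos[of m] by (simp add: field_simps)
  have dec: "(?a (Suc m) + 1) / ?P (Suc m) \<le> (?a m + 1) / ?P m" for m
  proof -
    have "real (d (Suc m)) + 1 \<le> real (Q (Suc m))" using lt[of m] by linarith
    then have "?a (Suc m) + 1 \<le> real (Q (Suc m)) * (?a m + 1)"
      by (simp add: algebra_simps)
    then have "(?a (Suc m) + 1) / ?P (Suc m) \<le> (real (Q (Suc m)) * (?a m + 1)) / ?P (Suc m)"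
      using base_prod_pos[of "Suc m"] by (intro divide_right_mono) auto
    then show ?thesis using Qpos[of m] by simp
  qed
  \<comment> \<open>The exclusion of eventually maximal digits enters here: the non-maximal digit at
    \<open>Suc j\<close>, beyond \<open>n\<close>, makes the upper end drop strictly.\<close>
  have strict: "(?a (Suc j) + 1) / ?P (Suc j) < (?a j + 1) / ?P j"
  proof -
    have "real (d (Suc j)) + 1 < real (Q (Suc j))" using lt[of j] j(2) by linarith
    then have "?a (Suc j) + 1 < real (Q (Suc j)) * (?a j + 1)"
      by (simp add: algebra_simps)
    then have "(?a (Suc j) + 1) / ?P (Suc j) < (real (Q (Suc j)) * (?a j + 1)) / ?P (Suc j)"
      using base_prod_pos[of "Suc j"] by (intro divide_strict_right_mono) auto
    then show ?thesis using Qpos[of j] by simp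
  qed
  have "incseq (\<lambda>n. ?a n / ?P n)" using inc by (rule incseq_SucI)
  then have lower: "?a n / ?P n \<le> z" using lim by (rule incseq_le)
  have decs: "decseq (\<lambda>n. (?a n + 1) / ?P n)" using dec by (rule decseq_SucI)
  have "(\<lambda>n. ?a n / ?P n + 1 / ?P n) \<longlonglongrightarrow> z + 0"
    by (intro tendsto_add lim inverse_base_prod_tendsto_0)
  then have "(\<lambda>n. (?a n + 1) / ?P n) \<longlonglongrightarrow> z" by (simp add: add_divide_distrib)
  with decs have "z \<le> (?a (Suc j) + 1) / ?P (Suc j)" by (rule decseq_ge)
  also have "\<dots> < (?a j + 1) / ?P j" by (rule strict)
  also have "\<dots> \<le> (?a n + 1) / ?P n" using decs j(1) by (simp add: decseq_def)
  finally have "z < (?a n + 1) / ?P n" .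
  with lower show ?thesis
    using base_prod_pos[of n] by (intro floor_unique) (simp_all add: field_simps)
qed

text \<open>The floors of \<open>z * base_prod Q n\<close> determine all numerators, and two
  consecutive numerators determine the digit between them.\<close>

lemma cantor_expansion_unique:
  assumes "is_cantor_expansion Q z d" "is_cantor_expansion Q z e"
  shows "d (Suc n) = e (Suc n)"
proof -
  have "digit_int Q d m = digit_int Q e m" for m
    using assms by (metis floor_eq_digit_int)
  from this[of n] this[of "Suc n"] show ?thesis by simp
qed

text \<open>Greedy algorithm: scale the current remainder by the next base, take the integer part as
  the digit and keep the fractional part.\<close>

lemma cantor_expansion_exists:
  assumes z: "0 \<le> z" "z < 1"
  shows "\<exists>d. is_cantor_expansion Q z d \<and> d 0 = 0"
proof -
  let ?P = "base_prod Q"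
  define r where "r n = frac (z * ?P n)" for n
  have r: "0 \<le> r n" "r n < 1" for n by (simp_all add: r_def frac_lt_1)
  define d where "d n = (case n of 0 \<Rightarrow> 0 | Suc m \<Rightarrow> nat \<lfloor>real (Q (Suc m)) * r m\<rfloor>)" for n
  have dS: "int (d (Suc m)) = \<lfloor>real (Q (Suc m)) * r m\<rfloor>" for m
    using r(1)[of m] by (simp add: d_def)
  \<comment> \<open>Splits off an integer, so that the floors obey the recursion of
    \<open>digit_int\<close>.\<close>
  have step: "z * ?P (Suc n) = real (Q (Suc n)) * r n + of_int (int (Q (Suc n)) * \<lfloor>z * ?P n\<rfloor>)" for n
    by (simp add: r_def frac_def algebra_simps)
  have fl: "\<lfloor>z * ?P (Suc n)\<rfloor> = int (Q (Suc n)) * \<lfloor>z * ?P n\<rfloor> + int (d (Suc n))" for n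
    unfolding step dS floor_add_int[symmetric] by simp
  have a: "digit_int Q d n = \<lfloor>z * ?P n\<rfloor>" for n
  proof (induction n)
    case 0
    then show ?case using z by (simp add: floor_eq_iff)
  next
    case (Suc n)
    then show ?case using fl by simp
  qed
  have lt: "d (Suc n) < Q (Suc n)" for n
  proof -
    have "real (Q (Suc n)) * r n < real (Q (Suc n)) * 1"
      using r(2)[of n] base_ge_2[of n] by (intro mult_strict_left_mono) auto
    then have "int (d (Suc n)) < int (Q (Suc n))" unfolding dS by (simp add: floor_less_iff)
    then show ?thesis by simp
  qed
  have rS: "r (Suc n) = real (Q (Suc n)) * r n - real (d (Suc n))" for n
  proof -
    have "r (Suc n) = z * ?P (Suc n) - of_int \<lfloor>z * ?P (Suc n)\<rfloor>" by (simp add: r_def frac_def)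
    also have "\<dots> = real (Q (Suc n)) * r n - real (d (Suc n))" unfolding fl step by (simp flip: dS)
    finally show ?thesis .
  qed
  have inf: "\<exists>m\<ge>n. d (Suc m) \<noteq> Q (Suc m) - 1" for n
  proof (rule ccontr)
    assume "\<not> ?thesis"
    then have max: "d (Suc m) = Q (Suc m) - 1" if "m \<ge> n" for m using that by blast
    \<comment> \<open>A maximal digit multiplies the gap \<open>1 - r\<close> by the base, which is
      at least 2. If all later digits were maximal, the gap would exceed 1, although
      \<open>r\<close> is nonnegative.\<close>
    have grow: "2 ^ k * (1 - r n) \<le> 1 - r (n + k)" for k
    proof (induction k)
      case (Suc k)
      have "real (d (Suc (n + k))) = real (Q (Suc (n + k))) - 1"
        using max[of "n + k"] base_ge_2[of "n + k"] by simp
      then have "1 - r (n + Suc k) = real (Q (Suc (n + k))) * (1 - r (n + k))"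
        by (simp add: rS algebra_simps)
      moreover have "2 * (1 - r (n + k)) \<le> real (Q (Suc (n + k))) * (1 - r (n + k))"
        using base_ge_2[of "n + k"] r(2)[of "n + k"] by (intro mult_right_mono) auto
      ultimately show ?case using Suc by simp
    qed simp
    obtain k where "1 / (1 - r n) < 2 ^ k"
      using real_arch_pow[of 2 "1 / (1 - r n)"] by auto
    then have "1 < 2 ^ k * (1 - r n)" using r(2)[of n] by (simp add: field_simps)
    with grow[of k] r(1)[of "n + k"] show False by linarith
  qed
  have lim: "(\<lambda>n. digit_int Q d n / ?P n) \<longlonglongrightarrow> z"
  proof (rule tendsto_sandwich)
    have "(\<lambda>n. z - 1 / ?P n) \<longlonglongrightarrow> z - 0"
      by (intro tendsto_diff tendsto_const inverse_base_prod_tendsto_0)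
    then show "(\<lambda>n. z - 1 / ?P n) \<longlonglongrightarrow> z" by simp
    show "\<forall>\<^sub>F n in sequentially. digit_int Q d n / ?P n \<le> z"
      unfolding a using base_prod_pos by (simp add: pos_divide_le_eq)
    show "\<forall>\<^sub>F n in sequentially. z - 1 / ?P n \<le> digit_int Q d n / ?P n"
    proof (rule always_eventually, rule allI)
      fix n
      have "z * ?P n - 1 \<le> \<lfloor>z * ?P n\<rfloor>" by linarith
      then have "(z * ?P n - 1) / ?P n \<le> \<lfloor>z * ?P n\<rfloor> / ?P n"
        using base_prod_pos[of n] by (intro divide_right_mono) auto
      then show "z - 1 / ?P n \<le> digit_int Q d n / ?P n"
        unfolding a using base_prod_pos[of n] by (simp add: diff_divide_distrib)
    qed
  qed simp
  have "is_cantor_expansion Q z d" unfolding is_cantor_expansion_iff using lt inf lim by blast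
  moreover have "d 0 = 0" by (simp add: d_def)
  ultimately show ?thesis by blast
qed

text \<open>Justifies the definite description: fixing index 0 turns agreement of digits at positive
  indices into equality of functions.\<close>

lemma cantor_digit_is_expansion:
  assumes "0 \<le> z" "z < 1"
  shows "is_cantor_expansion Q z (cantor_digit Q z)"
proof -
  have "\<exists>!d. is_cantor_expansion Q z d \<and> d 0 = 0"
  proof (rule ex_ex1I)
    fix d e
    assume *: "is_cantor_expansion Q z d \<and> d 0 = 0" "is_cantor_expansion Q z e \<and> e 0 = 0"
    show "d = e"
    proof
      fix n
      show "d n = e n"
        using * cantor_expansion_unique[of z d e] by (cases n) auto
    qed
  qed (rule cantor_expansion_exists[OF assms])
  from theI'[OF this] show ?thesis by (simp add: cantor_digit_def)
qed

lemma cantor_digit_less: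
  assumes "0 \<le> z" "z < 1" "n \<ge> 1"
  shows "cantor_digit Q z n < Q n"
  using cantor_digit_is_expansion[OF assms(1,2)] assms(3) by (simp add: is_cantor_expansion_def)

end

section \<open>Averaging over digit blocks\<close>

lemma finite_card_digit_blocks:
  "finite {D. list_all2 (<) D B} \<and> card {D. list_all2 (<) D B} = prod_list B"
  for B :: "nat list"
proof (induction B)
  case (Cons b B)
  have eq: "{D. list_all2 (<) D (b # B)} =
      (\<lambda>(x, xs). x # xs) ` ({..<b} \<times> {D. list_all2 (<) D B})"
    by (auto simp: list_all2_Cons2 image_iff)
  have "inj_on (\<lambda>(x, xs). x # xs) ({..<b} \<times> {D. list_all2 (<) D B})"
    by (auto simp: inj_on_def)
  then show ?case unfolding eq using Cons by (simp add: card_image card_cartesian_product)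
qed simp

text \<open>Each occurrence of \<open>B\<close> carries exactly one digit block, the block
  \<open>g j\<close> read off from \<open>z\<close>, and it is entrywise below \<open>B\<close>.
  Grouping the occurrences by that block counts each of them once.\<close>

lemma sum_block_count:
  assumes "basic_sequence Q" "0 \<le> z" "z < 1"
  shows "(\<Sum>D | list_all2 (<) D B. block_count Q D B z n) = card (block_positions Q B \<inter> {1..n})"
proof -
  let ?S = "block_positions Q B \<inter> {1..n}" and ?T = "{D. list_all2 (<) D B}"
  define g where "g j = map (\<lambda>i. cantor_digit Q z (j + i)) [0..<length B]" for j
  have "g j \<in> ?T" if "j \<in> ?S" for j
    using that cantor_digit_less[OF assms]
    by (auto simp: g_def list_all2_conv_all_nth block_positions_def) (metis le_add1 le_trans)
  then have "(\<Sum>D\<in>?T. \<Sum>j\<in>{j \<in> ?S. g j = D}. 1) = (\<Sum>j\<in>?S. (1::nat))"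
    by (intro sum.group) (auto simp: finite_card_digit_blocks)
  moreover have "block_count Q D B z n = card {j \<in> ?S. g j = D}" if "D \<in> ?T" for D
  proof -
    have "length D = length B" using that by (simp add: list_all2_lengthD)
    then have "(\<forall>i<length D. cantor_digit Q z (j + i) = D ! i) \<longleftrightarrow> g j = D" for j
      unfolding g_def list_eq_iff_nth_eq by simp
    then show ?thesis unfolding block_count_def by simp
  qed
  ultimately show ?thesis by simp
qed

lemma unif_ratio_normal_subset:
  assumes Q: "basic_sequence Q"
  shows "unif_ratio_normal Q \<subseteq> unif_normal Q"
proof
  fix z
  assume z: "z \<in> unif_ratio_normal Q"
  then have z01: "0 \<le> z" "z < 1" by (auto simp: unif_ratio_normal_def)
  have "(\<lambda>n. real (block_count Q E B z n) / expected_count Q E B n) \<longlonglongrightarrow> 1"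
    if l: "l \<ge> 1" "length E = l" "length B = l" "\<forall>b\<in>set B. b \<ge> 2"
      and lim: "filterlim (expected_count Q E B) at_top sequentially" for l E B
  proof -
    let ?T = "{D. list_all2 (<) D B}" and ?p = "real (prod_list B)"
    let ?c = "\<lambda>n. card (block_positions Q B \<inter> {1..n})"
    define r where "r D n = real (block_count Q D B z n) / expected_count Q D B n" for D n
    have pos: "\<forall>\<^sub>F n in sequentially. expected_count Q E B n > 0"
      using lim by (simp add: filterlim_at_top_dense)
    then obtain n0 where n0: "expected_count Q E B n0 > 0"
      using eventually_happens by fastforce
    \<comment> \<open>Since \<open>expected_count\<close> defaults to 0, a single positive value
      yields two premises of ratio normality: \<open>E\<close> is entrywise below \<open>B\<close>,
      and \<open>B\<close> occurs in \<open>Q\<close>.\<close>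
    then have E: "list_all2 (<) E B" by (auto simp: expected_count_def split: if_splits)
    have ne: "block_positions Q B \<noteq> {}" using n0 E by (auto simp: expected_count_def)
    have "0 \<notin> set B" using l(4) by fastforce
    then have p0: "?p > 0" by (metis gr0I of_nat_0_less_iff prod_list_zero_iff)
    have "(\<lambda>n. r D n / r E n) \<longlonglongrightarrow> 1" if "D \<in> ?T" for D
    proof -
      have "length D = l" using that l by (auto dest: list_all2_lengthD)
      with z l that E ne show ?thesis
        unfolding unif_ratio_normal_def r_def by blast
    qed
    then have "(\<lambda>n. \<Sum>D\<in>?T. r D n / r E n) \<longlonglongrightarrow> (\<Sum>D\<in>?T. 1)"
      by (intro tendsto_sum) auto
    then have "(\<lambda>n. \<Sum>D\<in>?T. r D n / r E n) \<longlonglongrightarrow> ?p"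
      by (simp add: finite_card_digit_blocks)
    moreover have "\<forall>\<^sub>F n in sequentially. (\<Sum>D\<in>?T. r D n / r E n) = ?p / r E n"
      using pos
    proof eventually_elim
      case (elim n)
      then have c0: "real (?c n) \<noteq> 0" using E by (auto simp: expected_count_def)
      \<comment> \<open>All blocks \<open>D\<close> share the expected count
        \<open>?c n / ?p\<close>, while the actual counts add up to \<open>?c n\<close>; so the
        ratios sum to exactly \<open>?p\<close>.\<close>
      have "(\<Sum>D\<in>?T. r D n) = (\<Sum>D\<in>?T. real (block_count Q D B z n) * (?p / real (?c n)))"
        by (intro sum.cong) (auto simp: r_def expected_count_def)
      also have "\<dots> = real (\<Sum>D\<in>?T. block_count Q D B z n) * (?p / real (?c n))"
        unfolding of_nat_sum sum_distrib_right ..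
      also have "\<dots> = ?p" unfolding sum_block_count[OF Q z01]
        using nonzero_mult_div_cancel_left[OF c0] by (simp only: times_divide_eq_right)
      finally show ?case by (simp add: sum_divide_distrib[symmetric])
    qed
    ultimately have "(\<lambda>n. ?p / r E n) \<longlonglongrightarrow> ?p"
      by (rule Lim_transform_eventually)
    \<comment> \<open>Inverting twice recovers \<open>r E n\<close> for every \<open>n\<close>: if
      it is 0, both divisions by zero give 0.\<close>
    then have "(\<lambda>n. ?p / (?p / r E n)) \<longlonglongrightarrow> ?p / ?p"
      using p0 by (intro tendsto_divide tendsto_const) auto
    then show ?thesis using p0 by (simp add: r_def)
  qed
  then show "z \<in> unif_normal Q" using z01 by (simp add: unif_normal_def)
qed

section \<open>Frequencies of blocks in dynamically generated sequences\<close>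

text \<open>The frequency \<open>c\<close> is the measure of the cylinder of \<open>B\<close>. It is
  positive because \<mu> charges every nonempty open set and the orbit of \<open>x\<close> visits
  the cylinder wherever \<open>B\<close> occurs.\<close>

lemma block_frequency:
  assumes "dynamically_generated TYPE('a::polish_space) Q" "block_positions Q B \<noteq> {}"
  obtains c where "c > 0"
    "(\<lambda>n. real (card (block_positions Q B \<inter> {1..n})) / real n) \<longlonglongrightarrow> c"
proof -
  obtain \<mu> :: "'a measure" and T f x where
    mps: "continuous_mps \<mu> T"
    and f: "continuous_map euclidean (discrete_topology {2..}) f"
    and gen: "generic_point \<mu> T x"
    and Q: "\<And>n. n \<ge> 1 \<Longrightarrow> Q n = f ((T ^^ n) x)"
    using assms(1) unfolding dynamically_generated_def by metis
  interpret prob_space \<mu> using mps by (simp add: continuous_mps_def)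
  have T: "continuous_on UNIV T" and sets: "sets \<mu> = sets borel"
    using mps by (auto simp: continuous_mps_def)
  have Tn: "continuous_on UNIV (T ^^ i)" for i
  proof (induction i)
    case (Suc i)
    then show ?case
      by (auto intro!: continuous_on_compose2[OF T] simp: comp_def)
  qed (simp add: continuous_on_id)
  have f_open: "open (f -` {b})" for b
  \<comment> \<open>The discrete target is \<open>{2..}\<close>, so smaller values must be treated
    apart; their preimages are empty.\<close>
  proof (cases "b \<ge> 2")
    case True
    then have "openin euclidean {y \<in> topspace euclidean. f y \<in> {b}}"
      by (intro openin_continuous_map_preimage[OF f]) auto
    then show ?thesis by (simp add: vimage_def)
  next
    case False
    have "f y \<ge> 2" for y
      using continuous_map_image_subset_topspace[OF f] by auto
    with False have "f -` {b} = {}" by auto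
    then show ?thesis by simp
  qed
  \<comment> \<open>The iterates start at 0, so that \<open>(T ^^ j) x\<close> lies in
    \<open>C\<close> exactly when \<open>B\<close> starts at position \<open>j\<close>, without a
    shift. This is claimed only for positive \<open>j\<close>, where \<open>Q\<close> follows the
    orbit.\<close>
  define C where "C = (\<Inter>i<length B. (T ^^ i) -` (f -` {B ! i}))"
  \<comment> \<open>Allowing arbitrary \<open>A\<close> covers complements too, which is what
    closedness of \<open>C\<close> requires.\<close>
  have f_clopen: "open (f -` A)" for A
  proof -
    have "f -` A = (\<Union>b\<in>A. f -` {b})" by auto
    with f_open show ?thesis by (simp add: open_UN)
  qed
  have pre_open: "open ((T ^^ i) -` (f -` A))" for i A
    using Tn f_clopen by (simp add: continuous_on_open_vimage)
  have C_open: "open C" unfolding C_def using pre_open by (intro open_INT) auto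
  have "- C = (\<Union>i<length B. (T ^^ i) -` (f -` (- {B ! i})))" by (auto simp: C_def)
  then have C_closed: "closed C" by (simp add: closed_def open_UN pre_open)
  have C_sets: "C \<in> sets \<mu>" using C_open sets by simp
  have in_C: "(T ^^ j) x \<in> C \<longleftrightarrow> j \<in> block_positions Q B" if "j \<ge> 1" for j
  proof -
    have "(T ^^ i) ((T ^^ j) x) = (T ^^ (j + i)) x" for i
      by (simp add: funpow_add add.commute[of j])
    then show ?thesis using that Q by (auto simp: C_def block_positions_def)
  qed
  obtain j where "j \<in> block_positions Q B" using assms(2) by auto
  moreover from this have "j \<ge> 1" by (simp add: block_positions_def)
  ultimately have "C \<noteq> {}" using in_C by auto
  with C_open mps have "emeasure \<mu> C > 0" by (simp add: continuous_mps_def)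
  then have c_pos: "measure \<mu> C > 0" by (simp add: emeasure_eq_measure)
  let ?h = "indicator C :: 'a \<Rightarrow> complex"
  have "continuous_on UNIV ?h"
  proof -
    have "continuous_on (C \<union> - C) (\<lambda>y. if y \<in> C then (1::complex) else 0)"
      using C_open C_closed
      by (intro continuous_on_cases continuous_on_const) (auto simp: open_closed)
    then show ?thesis by (simp add: indicator_def of_bool_def)
  qed
  moreover have "integrable \<mu> ?h"
    using C_sets
    by (intro integrable_const_bound[where B = 1]) (auto simp: indicator_def)
  ultimately have "(\<lambda>N. (\<Sum>n=1..N. ?h ((T ^^ n) x)) / of_nat N) \<longlonglongrightarrow> integral\<^sup>L \<mu> ?h"
    using gen by (simp add: generic_point_def)
  moreover have "integral\<^sup>L \<mu> ?h = of_real (measure \<mu> C)"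
  proof -
    have "?h = (\<lambda>y. complex_of_real (indicator C y))" by (auto simp: indicator_def)
    then show ?thesis using C_sets by simp
  qed
  moreover have "(\<Sum>n=1..N. ?h ((T ^^ n) x)) / of_nat N =
      of_real (real (card (block_positions Q B \<inter> {1..N})) / real N)" for N
  proof -
    have "(\<Sum>n=1..N. ?h ((T ^^ n) x)) = (\<Sum>n=1..N. indicator (block_positions Q B) n)"
      using in_C by (intro sum.cong) (auto simp: indicator_def)
    also have "\<dots> = of_nat (card (block_positions Q B \<inter> {1..N}))"
      by (simp add: indicator_def of_bool_def sum.If_cases Int_commute)
    finally show ?thesis by simp
  qed
  ultimately have "(\<lambda>n. real (card (block_positions Q B \<inter> {1..n})) / real n) \<longlonglongrightarrow> measure \<mu> C"
    by (simp only: tendsto_of_real_iff)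
  with c_pos show thesis by (rule that)
qed

text \<open>A positive frequency makes the count grow linearly: it is \<open>n\<close> times a
  factor with positive limit. Thus mere occurrence of \<open>B\<close> yields the divergence that
  uniform normality presupposes.\<close>

lemma expected_count_at_top:
  assumes "dynamically_generated TYPE('a::polish_space) Q" "block_positions Q B \<noteq> {}"
    and D: "list_all2 (<) D B" and B: "\<forall>b\<in>set B. b \<ge> 2"
  shows "filterlim (expected_count Q D B) at_top sequentially"
proof -
  let ?k = "\<lambda>n. real (card (block_positions Q B \<inter> {1..n}))"
  obtain c where c: "c > 0" "(\<lambda>n. ?k n / real n) \<longlonglongrightarrow> c"
    using block_frequency[OF assms(1,2)] .
  have "0 \<notin> set B" using B by fastforce
  then have p0: "real (prod_list B) > 0"
    by (metis gr0I of_nat_0_less_iff prod_list_zero_iff)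
  have "(\<lambda>n. ?k n / real n / real (prod_list B)) \<longlonglongrightarrow> c / real (prod_list B)"
    using c p0 by (intro tendsto_divide tendsto_const) auto
  then have "filterlim (\<lambda>n. ?k n / real n / real (prod_list B) * real n) at_top sequentially"
    by (rule filterlim_tendsto_pos_mult_at_top) (use c p0 filterlim_real_sequentially in auto)
  moreover have "?k n / real n / real (prod_list B) * real n = expected_count Q D B n" for n
    \<comment> \<open>At \<open>n = 0\<close>, where \<open>n\<close> cannot be cancelled, both
      sides are 0.\<close>
    using D by (cases "n = 0") (simp_all add: expected_count_def)
  ultimately show ?thesis by simp
qed

theorem theorem6p3:
  fixes Q :: "nat \<Rightarrow> nat"
  assumes "basic_sequence Q"
    and "dynamically_generated TYPE('a::polish_space) Q"
  shows "unif_ratio_normal Q = unif_normal Q"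
proof (rule equalityI[OF unif_ratio_normal_subset[OF assms(1)]], rule subsetI)
  fix z
  assume z: "z \<in> unif_normal Q"
  have lim: "(\<lambda>n. real (block_count Q D B z n) / expected_count Q D B n) \<longlonglongrightarrow> 1"
    if "l \<ge> 1" "length D = l" "length B = l" "\<forall>b\<in>set B. b \<ge> 2"
      "list_all2 (<) D B" "block_positions Q B \<noteq> {}" for l D B
    using z that expected_count_at_top[OF assms(2) that(6,5,4)]
    unfolding unif_normal_def by blast
  have "(\<lambda>n. (real (block_count Q D1 B1 z n) / expected_count Q D1 B1 n) /
      (real (block_count Q D2 B2 z n) / expected_count Q D2 B2 n)) \<longlonglongrightarrow> 1"
    if "l \<ge> 1" "length D1 = l" "length D2 = l" "length B1 = l" "length B2 = l"
      "\<forall>b\<in>set B1. b \<ge> 2" "\<forall>b\<in>set B2. b \<ge> 2"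
      "list_all2 (<) D1 B1" "list_all2 (<) D2 B2"
      "block_positions Q B1 \<noteq> {}" "block_positions Q B2 \<noteq> {}" for l D1 D2 B1 B2
    \<comment> \<open>The denominator has limit 1, hence a nonzero one, so the limit of the quotient
      is 1 / 1.\<close>
    using tendsto_divide[OF lim[of l D1 B1] lim[of l D2 B2]] that by simp
  moreover have "z \<in> {0..<1}" using z by (simp add: unif_normal_def)
  ultimately show "z \<in> unif_ratio_normal Q" by (simp add: unif_ratio_normal_def)
qed

end
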